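(* Let $L\ge 1$ be an integer, $0\le r<1/2$, and let $K=L(1/2-r)$ (assumed to be a positive integer). Let $C_{\rm min}=1/8$ and let $s_v>0$ satisfy $s_vL/K<C_{\rm min}$, i.e. $s_v<\frac{1}{16}(1-2r)$. In the forging scenario for the BB84 quantum digital signature protocol (described in the context), for every strategy of Bob, including arbitrary joint (coherent) measurements on his whole sequence of states, the probability that Bob, by measuring his sequence of states, generates a signature declaration with fewer than $s_vL$ mismatches with Charlie's record satisfies $$p({\rm forge})\le \exp\!\left(-2\left(C_{\rm min}-\frac{s_vL}{K}\right)^2K\right).$$ In particular, for fixed $r$ and $s_v$, the forging probability decays exponentially with the signature length $L$ for all possible attacks.
   Context: The BB84 states are the four qubit states $|0\rangle,\ |1\rangle,\ |+\rangle=\frac{1}{\sqrt2}(|0\rangle+|1\rangle),\ |-\rangle=\frac1{\sqrt2}(|0\rangle-|1\rangle)$. USE (unambiguous state elimination) measurement: one picks the basis $\{|0\rangle,|1\rangle\}$ or $\{|+\rangle,|-\rangle\}$ uniformly at random (independently of everything else), measures the qubit in it, and rules out (excludes) the BB84 state orthogonal to the outcome obtained. Thus one of the four states is excluded, never the one actually sent. Protocol background: Alice sends to each of Bob and Charlie one copy of a length-$L$ sequence of independent uniformly random BB84 states (all channels are ideal and authenticated, so the states sent are the states received). Charlie independently keeps or forwards to Bob each of his qubits; the protocol is aborted unless the number forwarded lies between $L(1/2-r)$ and $L(1/2+r)$. Charlie performs USE measurements. A forwarded declaration (a list of BB84 states, one per position) is accepted by Charlie if it causes fewer than $s_vL$ mismatches,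 where a mismatch is a position at which the declared state is one that Charlie excluded. Forging scenario (Bob dishonest, Alice and Charlie honest; worst case for Charlie): only the elements that Charlie received directly from Alice and kept matter, and it is assumed that there are exactly $K=L(1/2-r)$ of these, with positions known to Bob. So: $K$ independent uniformly random BB84 states are prepared in two copies each; Bob holds one copy of each and Charlie the other; Charlie makes independent USE measurements on his $K$ qubits; Bob performs an arbitrary quantum measurement (any POVM on $(\mathbb{C}^2)^{\otimes K}$, possibly with ancillas), without access to Charlie's bases or outcomes, and declares a BB84 state for each of the $K$ positions. Forging succeeds if among these $K$ positions there are fewer than $s_vL$ at which the state declared by Bob equals the state excluded by Charlie. *)

theory Defs
  imports "HOL-Probability.Product_PMF" "Jordan_Normal_Form.Schur_Decomposition"
begin

no_notation inner (infix \<open>\<bullet>\<close> 70)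

section \<open>Finite-dimensional quantum states and measurements\<close>

definition mat_trace :: "complex mat \<Rightarrow> complex" where
  "mat_trace A = (\<Sum>i<dim_row A. A $$ (i, i))"

definition pos_semidef :: "nat \<Rightarrow> complex mat \<Rightarrow> bool" where
  "pos_semidef n A \<longleftrightarrow> A \<in> carrier_mat n n \<and> mat_adjoint A = A \<and>
     (\<forall>v\<in>carrier_vec n. 0 \<le> Re ((A *\<^sub>v v) \<bullet>c v))"

definition density_operator :: "nat \<Rightarrow> complex mat \<Rightarrow> bool" where
  "density_operator n A \<longleftrightarrow> pos_semidef n A \<and> mat_trace A = 1"

definition is_povm :: "nat \<Rightarrow> 'o set \<Rightarrow> ('o \<Rightarrow> complex mat) \<Rightarrow> bool" where
  "is_povm n S M \<longleftrightarrow> finite S \<and> (\<forall>i\<in>S. pos_semidef n (M i)) \<and>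
     mat n n (\<lambda>ab. \<Sum>i\<in>S. M i $$ ab) = 1\<^sub>m n"

text \<open>
  Born rule: outcome distribution when the state \<open>\<rho>\<close> is measured with the POVM
  \<open>(M i)\<close>, \<open>i \<in> S\<close>. This is meaningful (\<^const>\<open>embed_pmf\<close> gets a probability mass function)
  whenever \<^term>\<open>density_operator n \<rho>\<close> and \<^term>\<open>is_povm n S M\<close>.
\<close>
definition born_pmf :: "complex mat \<Rightarrow> 'o set \<Rightarrow> ('o \<Rightarrow> complex mat) \<Rightarrow> 'o pmf" where
  "born_pmf \<rho> S M = embed_pmf (\<lambda>i. if i \<in> S then Re (mat_trace (\<rho> * M i)) else 0)"

definition ket_bra :: "complex vec \<Rightarrow> complex mat" where
  "ket_bra v = mat (dim_vec v) (dim_vec v) (\<lambda>(i, j). vec_index v i * cnj (vec_index v j))"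

definition kron :: "complex mat \<Rightarrow> complex mat \<Rightarrow> complex mat" where
  "kron A B = mat (dim_row A * dim_row B) (dim_col A * dim_col B)
     (\<lambda>(i, j). A $$ (i div dim_row B, j div dim_col B) * B $$ (i mod dim_row B, j mod dim_col B))"

definition tensor_list :: "complex mat list \<Rightarrow> complex mat" where
  "tensor_list As = foldr kron As (1\<^sub>m 1)"


section \<open>BB84 states and the USE measurement\<close>

datatype bb84 = Ket0 | Ket1 | KetPlus | KetMinus

fun bb84_vec :: "bb84 \<Rightarrow> complex vec" where
  "bb84_vec Ket0 = vec_of_list [1, 0]"
| "bb84_vec Ket1 = vec_of_list [0, 1]"
| "bb84_vec KetPlus = vec_of_list [complex_of_real (1 / sqrt 2), complex_of_real (1 / sqrt 2)]"
| "bb84_vec KetMinus = vec_of_list [complex_of_real (1 / sqrt 2), - complex_of_real (1 / sqrt 2)]"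

definition bb84_state :: "bb84 \<Rightarrow> complex mat" where
  "bb84_state s = ket_bra (bb84_vec s)"

fun orthogonal_bb84 :: "bb84 \<Rightarrow> bb84" where
  "orthogonal_bb84 Ket0 = Ket1"
| "orthogonal_bb84 Ket1 = Ket0"
| "orthogonal_bb84 KetPlus = KetMinus"
| "orthogonal_bb84 KetMinus = KetPlus"

definition bb84_bases :: "bb84 set set" where
  "bb84_bases = {{Ket0, Ket1}, {KetPlus, KetMinus}}"

text \<open>
  The excluded state when the USE measurement is applied to a qubit in state \<open>\<rho>\<close>: measuring in
  the basis \<open>b\<close> is the POVM with outcomes \<open>b\<close> whose elements are the projectors
  \<^term>\<open>bb84_state s\<close>, \<open>s \<in> b\<close>.
\<close>
definition use_pmf :: "complex mat \<Rightarrow> bb84 pmf" where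
  "use_pmf \<rho> = do {
     b \<leftarrow> pmf_of_set bb84_bases;
     s \<leftarrow> born_pmf \<rho> b bb84_state;
     return_pmf (orthogonal_bb84 s)
   }"


section \<open>The forging scenario\<close>

text \<open>
  A sequence of \<open>K\<close> BB84 states is a function on \<^typ>\<open>nat\<close> of which only the values at
  positions \<open>k < K\<close> matter.
\<close>
definition seq_state :: "nat \<Rightarrow> (nat \<Rightarrow> bb84) \<Rightarrow> complex mat" where
  "seq_state K x = tensor_list (map (\<lambda>k. bb84_state (x k)) [0..<K])"

text \<open>
  Bob adjoins an ancilla system, performs a joint POVM with outcomes \<open>0, \<dots>, n_outcomes - 1\<close>
  on his \<open>K\<close> qubits and the ancilla, and, given the outcome, declares a (possibly randomly
  chosen) sequence of BB84 states.
\<close>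
record bob_strategy =
  anc_dim :: nat
  anc_state :: "complex mat"
  n_outcomes :: nat
  povm :: "nat \<Rightarrow> complex mat"
  declare_pmf :: "nat \<Rightarrow> (nat \<Rightarrow> bb84) pmf"

definition valid_strategy :: "nat \<Rightarrow> bob_strategy \<Rightarrow> bool" where
  "valid_strategy K B \<longleftrightarrow>
     density_operator (anc_dim B) (anc_state B) \<and>
     is_povm (2 ^ K * anc_dim B) {..<n_outcomes B} (povm B)"

text \<open>
  Joint distribution of Bob's declaration and Charlie's record of excluded states. Both hold a
  copy of the same product state, so given the sequence \<open>x\<close> sent by Alice the global state is a
  product state and the two local measurements are independent.
\<close>
definition forging_experiment ::
  "nat \<Rightarrow> bob_strategy \<Rightarrow> ((nat \<Rightarrow> bb84) \<times> (nat \<Rightarrow> bb84)) pmf" where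
  "forging_experiment K B = do {
     x \<leftarrow> Pi_pmf {..<K} undefined (\<lambda>_. pmf_of_set {Ket0, Ket1, KetPlus, KetMinus});
     e \<leftarrow> Pi_pmf {..<K} undefined (\<lambda>k. use_pmf (bb84_state (x k)));
     i \<leftarrow> born_pmf (kron (seq_state K x) (anc_state B)) {..<n_outcomes B} (povm B);
     d \<leftarrow> declare_pmf B i;
     return_pmf (d, e)
   }"

definition mismatches :: "nat \<Rightarrow> (nat \<Rightarrow> bb84) \<Rightarrow> (nat \<Rightarrow> bb84) \<Rightarrow> nat" where
  "mismatches K d e = card {k. k < K \<and> d k = e k}"

text \<open>Probability of fewer than \<open>t\<close> mismatches among the \<open>K\<close> positions.\<close>
definition forge_prob :: "nat \<Rightarrow> real \<Rightarrow> bob_strategy \<Rightarrow> real" where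
  "forge_prob K t B =
     measure_pmf.prob (forging_experiment K B) {(d, e). real (mismatches K d e) < t}"

definition C_min :: real where
  "C_min = 1 / 8"

end

(*
  The basis in which Charlie measures is independent of everything else, so he excludes the state d
  declared at a position with an average operator whose smallest eigenvalue is 1/8 of the average
  state, whatever d is. For the moment generating function of the number of mismatches this becomes,
  for each of Bob's outcomes and each declaration, an inequality between sums of likelihoods of
  BB84 sequences. It is proved one position at a time, using only that likelihoods are
  nonnegative and that the states of either basis sum to the identity at each position, so it holds
  for joint measurements as well. Hence mismatches are at least as numerous, in the sense of this
  bound, as K independent events of probability 1/8, and the Chernoff-Hoeffding argument applies.
*)

theory Submission
  imports Defs "HOL-Probability.Hoeffding"
begin

section \<open>Traces, Kronecker products and positivity\<close>

lemma mat_trace_mult: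
  assumes "A \<in> carrier_mat n n" "B \<in> carrier_mat n n"
  shows "mat_trace (A * B) = (\<Sum>i<n. \<Sum>j<n. A $$ (i, j) * B $$ (j, i))"
  using assms by (simp add: mat_trace_def scalar_prod_def lessThan_atLeast0)

lemma mat_trace_add_mult:
  assumes "A \<in> carrier_mat n n" "B \<in> carrier_mat n n" "C \<in> carrier_mat n n"
  shows "mat_trace ((A + B) * C) = mat_trace (A * C) + mat_trace (B * C)"
proof -
  have AB: "A + B \<in> carrier_mat n n"
    using assms by simp
  show ?thesis
    unfolding mat_trace_mult[OF AB assms(3)] mat_trace_mult[OF assms(1,3)]
      mat_trace_mult[OF assms(2,3)] sum.distrib[symmetric]
    using assms by (intro sum.cong refl) (simp add: distrib_right)
qed

lemma kron_carrier:
  assumes "A \<in> carrier_mat m m" "B \<in> carrier_mat n n"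
  shows "kron A B \<in> carrier_mat (m * n) (m * n)"
  using assms unfolding kron_def by (intro carrier_matI) simp_all

lemma index_kron:
  assumes "A \<in> carrier_mat m m" "B \<in> carrier_mat n n" "i < m * n" "j < m * n"
  shows "kron A B $$ (i, j) = A $$ (i div n, j div n) * B $$ (i mod n, j mod n)"
  using assms by (simp add: kron_def)

lemma div_mod_less:
  fixes i m n :: nat
  assumes "i < m * n"
  shows "i div n < m" "i mod n < n"
proof -
  show "i div n < m"
    using assms by (rule less_mult_imp_div_less)
  have "0 < n"
    using assms by (cases n) auto
  then show "i mod n < n"
    by (rule mod_less_divisor)
qed

lemma kron_add_left:
  assumes "A \<in> carrier_mat m m" "B \<in> carrier_mat m m" "C \<in> carrier_mat n n"
  shows "kron (A + B) C = kron A C + kron B C"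
proof (rule eq_matI)
  have AB: "A + B \<in> carrier_mat m m"
    using assms by simp
  note K = kron_carrier[OF AB assms(3)] kron_carrier[OF assms(1,3)] kron_carrier[OF assms(2,3)]
  show "dim_row (kron (A + B) C) = dim_row (kron A C + kron B C)"
    "dim_col (kron (A + B) C) = dim_col (kron A C + kron B C)"
    using K by auto
  fix i j assume "i < dim_row (kron A C + kron B C)" "j < dim_col (kron A C + kron B C)"
  then have ij: "i < m * n" "j < m * n"
    using K by auto
  show "kron (A + B) C $$ (i, j) = (kron A C + kron B C) $$ (i, j)"
    using K ij assms div_mod_less[OF ij(1)] div_mod_less[OF ij(2)]
    by (simp add: index_kron[OF AB assms(3)] index_kron[OF assms(1,3)] index_kron[OF assms(2,3)]
        algebra_simps)
qed

lemma kron_add_right: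
  assumes "A \<in> carrier_mat m m" "B \<in> carrier_mat n n" "C \<in> carrier_mat n n"
  shows "kron A (B + C) = kron A B + kron A C"
proof (rule eq_matI)
  have BC: "B + C \<in> carrier_mat n n"
    using assms by simp
  note K = kron_carrier[OF assms(1) BC] kron_carrier[OF assms(1,2)] kron_carrier[OF assms(1,3)]
  show "dim_row (kron A (B + C)) = dim_row (kron A B + kron A C)"
    "dim_col (kron A (B + C)) = dim_col (kron A B + kron A C)"
    using K by auto
  fix i j assume "i < dim_row (kron A B + kron A C)" "j < dim_col (kron A B + kron A C)"
  then have ij: "i < m * n" "j < m * n"
    using K by auto
  show "kron A (B + C) $$ (i, j) = (kron A B + kron A C) $$ (i, j)"
    using K ij assms div_mod_less[OF ij(1)] div_mod_less[OF ij(2)]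
    by (simp add: index_kron[OF assms(1) BC] index_kron[OF assms(1,2)] index_kron[OF assms(1,3)]
        algebra_simps)
qed

text \<open>An index below \<open>m * n\<close> is the same as the pair of its quotient and
  remainder by n. Cutting the range into m blocks of length n factorises the sum; this is why the
  trace is multiplicative on Kronecker products.\<close>

lemma sum_div_mod:
  fixes f g :: "nat \<Rightarrow> 'a::comm_semiring_0"
  shows "(\<Sum>i<m * n. f (i div n) * g (i mod n)) = sum f {..<m} * sum g {..<n}"
proof -
  have "(\<Sum>i<m * n. f (i div n) * g (i mod n))
      = (\<Sum>a<m. \<Sum>i\<in>{a * n..<a * n + n}. f (i div n) * g (i mod n))"
    by (rule sum.nat_group[symmetric])
  also have "\<dots> = (\<Sum>a<m. \<Sum>b<n. f a * g b)"
  proof (rule sum.cong[OF refl])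
    fix a
    have "(\<Sum>i\<in>{a * n..<a * n + n}. f (i div n) * g (i mod n))
        = (\<Sum>b\<in>{0..<n}. f ((b + a * n) div n) * g ((b + a * n) mod n))"
      using sum.shift_bounds_nat_ivl[of "\<lambda>i. f (i div n) * g (i mod n)" 0 "a * n" n]
      by (simp add: add.commute)
    then show "(\<Sum>i\<in>{a * n..<a * n + n}. f (i div n) * g (i mod n)) = (\<Sum>b<n. f a * g b)"
      by (simp add: lessThan_atLeast0)
  qed
  finally show ?thesis
    by (simp add: sum_product)
qed

lemma mat_trace_kron:
  assumes "A \<in> carrier_mat m m" "B \<in> carrier_mat n n"
  shows "mat_trace (kron A B) = mat_trace A * mat_trace B"
proof -
  have "mat_trace (kron A B) = (\<Sum>i<m * n. A $$ (i div n, i div n) * B $$ (i mod n, i mod n))"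
    using kron_carrier[OF assms] by (auto simp: mat_trace_def index_kron[OF assms] intro!: sum.cong)
  then show ?thesis
    using assms sum_div_mod[where f = "\<lambda>i. A $$ (i, i)" and g = "\<lambda>i. B $$ (i, i)"]
    by (simp add: mat_trace_def)
qed

section \<open>Gram decomposition of positive semidefinite matrices\<close>

definition psd_form :: "nat \<Rightarrow> (nat \<Rightarrow> nat \<Rightarrow> complex) \<Rightarrow> (nat \<Rightarrow> complex) \<Rightarrow> real" where
  "psd_form n a v = Re (\<Sum>i<n. \<Sum>j<n. a i j * v j * cnj (v i))"

text \<open>Shifting v by c along the unit vector m produces two cross terms, which are complex
  conjugates because a is Hermitian. A suitable c then either drives the form negative or completes
  a square.\<close>

lemma psd_form_add_unit:
  assumes herm: "\<And>i j. i < n \<Longrightarrow> j < n \<Longrightarrow> a j i = cnj (a i j)" and m: "m < n"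
  shows "psd_form n a (\<lambda>j. v j + (if j = m then c else 0))
       = psd_form n a v + 2 * Re (cnj c * (\<Sum>j<n. a m j * v j)) + Re (a m m) * (cmod c)\<^sup>2"
proof -
  let ?B = "\<Sum>j<n. a m j * v j"
  have B: "(\<Sum>i<n. a i m * cnj (v i)) = cnj ?B"
    unfolding cnj_sum by (intro sum.cong refl) (simp add: herm[OF m])
  have e: "a i j * (v j + (if j = m then c else 0)) * cnj (v i + (if i = m then c else 0))
     = a i j * v j * cnj (v i) + (if j = m then c * (a i m * cnj (v i)) else 0)
       + (if i = m then cnj c * (a m j * v j) else 0)
       + (if i = m then if j = m then a m m * (c * cnj c) else 0 else 0)" for i j
    by (auto simp: algebra_simps)
  have "(\<Sum>j<n. a i j * (v j + (if j = m then c else 0)) * cnj (v i + (if i = m then c else 0)))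
      = (\<Sum>j<n. a i j * v j * cnj (v i)) + c * (a i m * cnj (v i))
        + (if i = m then cnj c * ?B + a m m * (c * cnj c) else 0)" for i
    unfolding e using m by (cases "i = m") (simp_all add: sum.distrib sum_distrib_left)
  then have "(\<Sum>i<n. \<Sum>j<n. a i j * (v j + (if j = m then c else 0)) * cnj (v i + (if i = m then c else 0)))
      = (\<Sum>i<n. \<Sum>j<n. a i j * v j * cnj (v i)) + c * (\<Sum>i<n. a i m * cnj (v i))
        + (cnj c * ?B + a m m * (c * cnj c))"
    using m by (simp add: sum.distrib sum_distrib_left[symmetric])
  then have "psd_form n a (\<lambda>j. v j + (if j = m then c else 0))
      = psd_form n a v + Re (c * cnj ?B) + (Re (cnj c * ?B) + Re (a m m * (c * cnj c)))"
    unfolding psd_form_def B by (simp only: plus_complex.sel)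
  also have "Re (c * cnj ?B) = Re (cnj c * ?B)"
    by (metis cnj.simps(1) complex_cnj_cnj complex_cnj_mult)
  also have "Re (a m m * (c * cnj c)) = Re (a m m) * (cmod c)\<^sup>2"
    unfolding complex_norm_square[symmetric] by simp
  finally show ?thesis
    by simp
qed

text \<open>With a zero on the diagonal, the form at \<open>e_l - t * a m l * e_m\<close> is affine
  in t with slope \<open>-2 * (cmod (a m l))^2\<close>, so it could not stay nonnegative if
  \<open>a m l\<close> were nonzero.\<close>

lemma psd_form_zero_diagonal:
  assumes herm: "\<And>i j. i < n \<Longrightarrow> j < n \<Longrightarrow> a j i = cnj (a i j)"
    and psd: "\<And>v. 0 \<le> psd_form n a v" and m: "m < n" "a m m = 0" and l: "l < n"
  shows "a m l = 0"
proof (rule ccontr)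
  assume nz: "a m l \<noteq> 0"
  let ?e = "\<lambda>j. if j = l then 1 else 0 :: complex"
  \<comment> \<open>Chosen so that the form takes exactly the value -1.\<close>
  define t where "t = (psd_form n a ?e + 1) / (2 * (cmod (a m l))\<^sup>2)"
  have B: "(\<Sum>j<n. a m j * ?e j) = a m l"
    using l by (simp add: if_distrib sum.delta cong: if_cong)
  have "0 \<le> psd_form n a ?e + 2 * Re (cnj (- (complex_of_real t * a m l)) * a m l)"
    using psd[of "\<lambda>j. ?e j + (if j = m then - (complex_of_real t * a m l) else 0)"]
      psd_form_add_unit[where a = a and v = ?e and c = "- (complex_of_real t * a m l)", OF herm m(1)]
    unfolding B m(2) by simp
  also have "\<dots> = psd_form n a ?e - 2 * t * (cmod (a m l))\<^sup>2"
    unfolding cmod_power2 by (simp add: algebra_simps power2_eq_square)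
  also have "\<dots> = -1"
    using nz by (simp add: t_def field_simps)
  finally show False
    by simp
qed

text \<open>
  Symmetric Gaussian elimination: subtracting the rank-one form of row \<open>m\<close> clears that row and
  keeps the form positive semidefinite.
\<close>
lemma psd_gram_aux:
  assumes "\<And>i j. i < n \<Longrightarrow> j < n \<Longrightarrow> a j i = cnj (a i j)"
    and "\<And>v. 0 \<le> psd_form n a v"
    and "m \<le> n" and "\<And>i j. m \<le> i \<Longrightarrow> i < n \<Longrightarrow> j < n \<Longrightarrow> a i j = 0"
  shows "\<exists>w. \<forall>i<n. \<forall>j<n. a i j = (\<Sum>k<m. w k i * cnj (w k j))"
  using assms
proof (induction m arbitrary: a)
  case 0
  then show ?case by simp
next
  case (Suc m)
  note herm = Suc.prems(1) and psd = Suc.prems(2) and zero = Suc.prems(4)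
  have m: "m < n"
    using Suc.prems(3) by simp
  show ?case
  proof (cases "a m m = 0")
    case True
    \<comment> \<open>With a zero pivot, row m already vanishes, so there is nothing to subtract and
      the Gram vector number m can be zero.\<close>
    have "a i j = 0" if "m \<le> i" "i < n" "j < n" for i j
      using psd_form_zero_diagonal[OF herm psd m True that(3)] zero[of i j] that
      by (cases "i = m") auto
    from Suc.IH[OF herm psd _ this] m
    obtain w where w: "\<forall>i<n. \<forall>j<n. a i j = (\<Sum>k<m. w k i * cnj (w k j))"
      by auto
    show ?thesis
      by (rule exI[of _ "w(m := \<lambda>_. 0)"]) (use w in simp)
  next
    case False
    define p where "p = Re (a m m)"
    have "Im (a m m) = Im (cnj (a m m))"
      using herm[OF m m] by (rule arg_cong)
    then have amm: "a m m = complex_of_real p"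
      by (simp add: p_def complex_eq_iff)
    have "psd_form n a (\<lambda>_. 0) = 0"
      by (simp add: psd_form_def)
    then have "0 \<le> p"
      using psd_form_add_unit[where a = a and v = "\<lambda>_. 0" and c = 1, OF herm m]
        psd[of "\<lambda>j. 0 + (if j = m then 1 else 0)"]
      by (simp add: p_def)
    with False amm have p: "p > 0"
      by (cases "p = 0") auto
    \<comment> \<open>Column m divided by the square root of the pivot p: its rank-one form agrees
      with a on row and column m.\<close>
    define u where "u i = a i m / complex_of_real (sqrt p)" for i
    have uu: "u i * cnj (u j) = a i m * a m j / p" if "i < n" "j < n" for i j
      using p herm[OF that(2) m] by (simp add: u_def flip: of_real_mult)
    define b where "b i j = a i j - u i * cnj (u j)" for i j
    have hb: "b j i = cnj (b i j)" if "i < n" "j < n" for i j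
      using herm[OF that] by (simp add: b_def)
    have pb: "0 \<le> psd_form n b v" for v
    proof -
      define B where "B = (\<Sum>j<n. a m j * v j)"
      have cB: "(\<Sum>i<n. a i m * cnj (v i)) = cnj B"
        unfolding B_def cnj_sum by (intro sum.cong refl) (simp add: herm[OF m])
      have "(\<Sum>i<n. \<Sum>j<n. b i j * v j * cnj (v i))
          = (\<Sum>i<n. \<Sum>j<n. a i j * v j * cnj (v i) - (a i m * cnj (v i)) * (a m j * v j) / p)"
        by (intro sum.cong refl) (simp add: b_def uu algebra_simps)
      also have "\<dots> = (\<Sum>i<n. \<Sum>j<n. a i j * v j * cnj (v i)) - cnj B * B / p"
        unfolding cB[symmetric] unfolding B_def
        by (simp add: sum_subtractf sum_divide_distrib[symmetric] sum_product)
      finally have 1: "psd_form n b v = psd_form n a v - (cmod B)\<^sup>2 / p"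
        unfolding cmod_power2 by (simp add: psd_form_def power2_eq_square)
      \<comment> \<open>Completing the square: the shift \<open>- B / p\<close> along coordinate m
        minimises the form of a, and the minimum is the form of b at v.\<close>
      have "0 \<le> psd_form n a (\<lambda>j. v j + (if j = m then - B / p else 0))"
        by (rule psd)
      also have "\<dots> = psd_form n a v + 2 * Re (cnj (- B / p) * B) + p * (cmod (- B / p))\<^sup>2"
        using psd_form_add_unit[where a = a and v = v and c = "- B / p", OF herm m]
        unfolding B_def[symmetric] p_def[symmetric] .
      also have "Re (cnj (- B / p) * B) = - (cmod B)\<^sup>2 / p"
        unfolding cmod_power2 by (simp add: power2_eq_square add_divide_distrib diff_divide_distrib)
      also have "p * (cmod (- B / p))\<^sup>2 = (cmod B)\<^sup>2 / p"
        using p by (simp add: norm_divide power2_eq_square)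
      finally show ?thesis
        unfolding 1 by simp
    qed
    \<comment> \<open>Row m is cleared by the subtraction. The rows below it were zero already, so u
      vanishes there and they stay zero.\<close>
    have zb: "b i j = 0" if "m \<le> i" "i < n" "j < n" for i j
      using zero[of i j] zero[of i m] that m p
      by (cases "i = m") (auto simp: b_def uu amm)
    from Suc.IH[OF hb pb _ zb] m
    obtain w where w: "\<forall>i<n. \<forall>j<n. b i j = (\<Sum>k<m. w k i * cnj (w k j))"
      by auto
    have "a i j = (\<Sum>k<m. w k i * cnj (w k j)) + u i * cnj (u j)" if "i < n" "j < n" for i j
      using w that b_def[of i j] by (metis diff_add_cancel)
    then show ?thesis
      by (intro exI[of _ "w(m := u)"]) simp
  qed
qed

text \<open>Translates the predicate on matrices and vectors into entries and plain functions, on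
  which elimination acts without carrier conditions.\<close>

lemma pos_semidefD:
  assumes "pos_semidef n A"
  shows "A \<in> carrier_mat n n"
    and "\<And>i j. i < n \<Longrightarrow> j < n \<Longrightarrow> A $$ (j, i) = cnj (A $$ (i, j))"
    and "\<And>v. 0 \<le> psd_form n (\<lambda>i j. A $$ (i, j)) v"
proof -
  show A: "A \<in> carrier_mat n n"
    using assms by (simp add: pos_semidef_def)
  show "A $$ (j, i) = cnj (A $$ (i, j))" if "i < n" "j < n" for i j
  proof -
    have "A $$ (j, i) = mat_adjoint A $$ (j, i)"
      using assms by (simp add: pos_semidef_def)
    also have "\<dots> = cnj (A $$ (i, j))"
      using A that by (simp add: mat_adjoint_def mat_of_rows_def)
    finally show ?thesis .
  qed
  show "0 \<le> psd_form n (\<lambda>i j. A $$ (i, j)) v" for v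
  proof -
    have "0 \<le> Re ((A *\<^sub>v vec n v) \<bullet>c vec n v)"
      using assms by (simp add: pos_semidef_def)
    also have "(A *\<^sub>v vec n v) \<bullet>c vec n v = (\<Sum>i<n. \<Sum>j<n. A $$ (i, j) * v j * cnj (v i))"
      using A by (simp add: scalar_prod_def lessThan_atLeast0 sum_distrib_right)
    finally show ?thesis
      by (simp add: psd_form_def)
  qed
qed

text \<open>Elimination starts at m = n, where the condition on vanishing rows is vacuous. The Gram
  vectors play the part of a square root of A.\<close>

lemma psd_gram:
  assumes "pos_semidef n A"
  shows "\<exists>w. \<forall>i<n. \<forall>j<n. A $$ (i, j) = (\<Sum>k<n. w k i * cnj (w k j))"
proof (rule psd_gram_aux)
  show "A $$ (j, i) = cnj (A $$ (i, j))" if "i < n" "j < n" for i j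
    by (rule pos_semidefD(2)[OF assms that])
  show "0 \<le> psd_form n (\<lambda>i j. A $$ (i, j)) v" for v
    by (rule pos_semidefD(3)[OF assms])
qed simp_all

text \<open>A Gram decomposition of S turns \<open>kron A S\<close> into a sum of rank-one matrices
  given by vectors \<open>u k\<close>, and the trace against M becomes the sum of the values of the
  form of M at these vectors.\<close>

lemma trace_rank_one_kron_nonneg:
  assumes A: "A \<in> carrier_mat m m" "\<And>i j. i < m \<Longrightarrow> j < m \<Longrightarrow> A $$ (i, j) = f i * cnj (f j)"
    and S: "pos_semidef n S" and M: "pos_semidef (m * n) M"
  shows "0 \<le> Re (mat_trace (kron A S * M))"
proof -
  note Sc = pos_semidefD(1)[OF S]
  obtain w where w: "\<And>i j. i < n \<Longrightarrow> j < n \<Longrightarrow> S $$ (i, j) = (\<Sum>k<n. w k i * cnj (w k j))"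
    using psd_gram[OF S] by auto
  define u where "u k i = f (i div n) * w k (i mod n)" for k i
  have "mat_trace (kron A S * M)
      = (\<Sum>i<m * n. \<Sum>j<m * n. kron A S $$ (i, j) * M $$ (j, i))"
    by (rule mat_trace_mult[OF kron_carrier[OF A(1) Sc] pos_semidefD(1)[OF M]])
  also have "\<dots> = (\<Sum>i<m * n. \<Sum>j<m * n. \<Sum>k<n. M $$ (j, i) * u k i * cnj (u k j))"
    by (intro sum.cong refl)
      (auto simp: index_kron[OF A(1) Sc] A(2) w div_mod_less u_def sum_distrib_left
        sum_distrib_right intro!: sum.cong)
  \<comment> \<open>The swaps bring k outermost and put j before i, so that each inner double sum is
    literally a \<open>psd_form\<close> of M.\<close>
  also have "\<dots> = (\<Sum>i<m * n. \<Sum>k<n. \<Sum>j<m * n. M $$ (j, i) * u k i * cnj (u k j))"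
    by (intro sum.cong refl sum.swap)
  also have "\<dots> = (\<Sum>k<n. \<Sum>i<m * n. \<Sum>j<m * n. M $$ (j, i) * u k i * cnj (u k j))"
    by (rule sum.swap)
  also have "\<dots> = (\<Sum>k<n. \<Sum>j<m * n. \<Sum>i<m * n. M $$ (j, i) * u k i * cnj (u k j))"
    by (intro sum.cong refl sum.swap)
  also have "Re \<dots> = (\<Sum>k<n. psd_form (m * n) (\<lambda>j i. M $$ (j, i)) (u k))"
    by (simp add: psd_form_def)
  also have "\<dots> \<ge> 0"
    by (intro sum_nonneg pos_semidefD(3)[OF M])
  finally show ?thesis .
qed

section \<open>The Born rule as a probability mass function\<close>

lemma sum_povm_trace:
  assumes "A \<in> carrier_mat n n" "is_povm n S M"
  shows "(\<Sum>i\<in>S. mat_trace (A * M i)) = mat_trace A"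
proof -
  have M: "M i \<in> carrier_mat n n" if "i \<in> S" for i
    using assms(2) that by (auto simp: is_povm_def pos_semidef_def)
  have I: "(\<Sum>i\<in>S. M i $$ (b, a)) = (if a = b then 1 else 0)" if "a < n" "b < n" for a b
  proof -
    have "(\<Sum>i\<in>S. M i $$ (b, a)) = mat n n (\<lambda>ab. \<Sum>i\<in>S. M i $$ ab) $$ (b, a)"
      using that by simp
    also have "\<dots> = (if a = b then 1 else 0)"
      using assms(2) that by (simp add: is_povm_def)
    finally show ?thesis .
  qed
  have "(\<Sum>i\<in>S. mat_trace (A * M i))
      = (\<Sum>i\<in>S. \<Sum>a<n. \<Sum>b<n. A $$ (a, b) * M i $$ (b, a))"
    by (intro sum.cong refl mat_trace_mult assms M)
  also have "\<dots> = (\<Sum>a<n. \<Sum>i\<in>S. \<Sum>b<n. A $$ (a, b) * M i $$ (b, a))"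
    by (rule sum.swap)
  also have "\<dots> = (\<Sum>a<n. \<Sum>b<n. \<Sum>i\<in>S. A $$ (a, b) * M i $$ (b, a))"
    by (intro sum.cong refl sum.swap)
  also have "\<dots> = (\<Sum>a<n. \<Sum>b<n. A $$ (a, b) * (if a = b then 1 else 0))"
    by (intro sum.cong refl) (simp add: sum_distrib_left[symmetric] I)
  also have "\<dots> = (\<Sum>a<n. A $$ (a, a))"
    by (intro sum.cong refl) (simp add: if_distrib cong: if_cong)
  finally show ?thesis
    using assms(1) by (simp add: mat_trace_def)
qed

text \<open>\<open>embed_pmf\<close> returns the given weights only if they are nonnegative with
  total mass 1. These two facts are supplied separately for Charlie's basis measurements and for
  Bob's POVM.\<close>

lemma pmf_born_pmf:
  assumes "finite S" "\<And>i. i \<in> S \<Longrightarrow> 0 \<le> Re (mat_trace (\<rho> * M i))"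
    and "(\<Sum>i\<in>S. Re (mat_trace (\<rho> * M i))) = 1"
  shows "pmf (born_pmf \<rho> S M) i = (if i \<in> S then Re (mat_trace (\<rho> * M i)) else 0)"
  unfolding born_pmf_def
proof (rule pmf_embed_pmf)
  let ?f = "\<lambda>i. if i \<in> S then Re (mat_trace (\<rho> * M i)) else 0"
  show nn: "0 \<le> ?f i" for i
    using assms(2) by simp
  have "(\<integral>\<^sup>+i. ennreal (?f i) \<partial>count_space UNIV) = (\<Sum>i\<in>S. ennreal (?f i))"
    using assms(1) by (intro nn_integral_count_space') auto
  also have "\<dots> = ennreal (\<Sum>i\<in>S. ?f i)"
    by (rule sum_ennreal) (use nn in blast)
  also have "(\<Sum>i\<in>S. ?f i) = 1"
    using assms(3) by simp
  finally show "(\<integral>\<^sup>+i. ennreal (?f i) \<partial>count_space UNIV) = 1"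
    by simp
qed

section \<open>Outcome probabilities\<close>

lemma tensor_list_Cons [simp]: "tensor_list (A # As) = kron A (tensor_list As)"
  by (simp add: tensor_list_def)

lemma tensor_list_carrier:
  assumes "\<forall>A\<in>set As. A \<in> carrier_mat 2 2"
  shows "tensor_list As \<in> carrier_mat (2 ^ length As) (2 ^ length As)"
  using assms
proof (induction As)
  case Nil
  then show ?case by (simp add: tensor_list_def)
next
  case (Cons A As)
  then show ?case using kron_carrier[of A 2 "tensor_list As" "2 ^ length As"] by simp
qed

text \<open>Additivity in a single tensor factor, which lets an identity between one-qubit operators
  be used at any position of a sequence.\<close>

lemma tensor_list_update_add:
  assumes "\<forall>A\<in>set As. A \<in> carrier_mat 2 2" "X \<in> carrier_mat 2 2" "Y \<in> carrier_mat 2 2"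
    and "k < length As"
  shows "tensor_list (As[k := X + Y]) = tensor_list (As[k := X]) + tensor_list (As[k := Y])"
  using assms
proof (induction As arbitrary: k)
  case (Cons A As)
  note C = tensor_list_carrier[of As]
  show ?case
  proof (cases k)
    case 0
    then show ?thesis
      using Cons.prems C by (simp add: kron_add_left[where m = 2 and n = "2 ^ length As"])
  next
    case (Suc l)
    have *: "\<forall>B\<in>set (As[l := Z]). B \<in> carrier_mat 2 2" if "Z \<in> carrier_mat 2 2" for Z
      using Cons.prems(1) that set_update_subset_insert[of As l Z] by auto
    show ?thesis
      using Suc Cons tensor_list_carrier[OF *[OF Cons.prems(2)]] tensor_list_carrier[OF *[OF Cons.prems(3)]]
      by (simp add: kron_add_right[where m = 2 and n = "2 ^ length As"])
  qed
qed simp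

lemma mat_trace_tensor_list:
  assumes "\<forall>A\<in>set As. A \<in> carrier_mat 2 2 \<and> mat_trace A = 1"
  shows "mat_trace (tensor_list As) = 1"
  using assms
proof (induction As)
  case Nil
  then show ?case by (simp add: tensor_list_def mat_trace_def)
next
  case (Cons A As)
  then show ?case
    using mat_trace_kron[of A 2 "tensor_list As" "2 ^ length As"] tensor_list_carrier[of As] by simp
qed

text \<open>A product of pure states is pure: its vector is the tensor product of the vectors, with
  the index split into quotient and remainder.\<close>

lemma tensor_list_rank_one:
  assumes "\<forall>A\<in>set As. A \<in> carrier_mat 2 2 \<and> (\<exists>f. \<forall>i<2. \<forall>j<2. A $$ (i, j) = f i * cnj (f j))"
  shows "\<exists>f. \<forall>i<2 ^ length As. \<forall>j<2 ^ length As. tensor_list As $$ (i, j) = f i * cnj (f j)"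
  using assms
proof (induction As)
  case Nil
  then show ?case by (intro exI[of _ "\<lambda>_. 1"]) (simp add: tensor_list_def)
next
  case (Cons A As)
  then obtain f g where f: "\<And>i j. i < 2 \<Longrightarrow> j < 2 \<Longrightarrow> A $$ (i, j) = f i * cnj (f j)"
    and g: "\<And>i j. i < 2 ^ length As \<Longrightarrow> j < 2 ^ length As \<Longrightarrow> tensor_list As $$ (i, j) = g i * cnj (g j)"
    by auto
  have A: "A \<in> carrier_mat 2 2"
    using Cons.prems by simp
  have T: "tensor_list As \<in> carrier_mat (2 ^ length As) (2 ^ length As)"
    using Cons.prems by (intro tensor_list_carrier) simp
  show ?case
    by (rule exI[of _ "\<lambda>i. f (i div 2 ^ length As) * g (i mod 2 ^ length As)"])
      (auto simp: index_kron[OF A T] f g div_mod_less simp del: One_nat_def)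
qed

section \<open>The BB84 states and sequences of them\<close>

lemma bb84_state_carrier: "bb84_state s \<in> carrier_mat 2 2"
  by (cases s) (auto simp: bb84_state_def ket_bra_def)

lemma dim_bb84_state [simp]: "dim_row (bb84_state s) = 2" "dim_col (bb84_state s) = 2"
  using bb84_state_carrier[of s] by auto

lemma dim_bb84_vec [simp]: "dim_vec (bb84_vec s) = 2"
  by (cases s) auto

lemma index_bb84_state:
  "i < 2 \<Longrightarrow> j < 2 \<Longrightarrow> bb84_state s $$ (i, j) = vec_index (bb84_vec s) i * cnj (vec_index (bb84_vec s) j)"
  by (simp add: bb84_state_def ket_bra_def)

lemma mat_trace_bb84_mult:
  "mat_trace (bb84_state x * bb84_state s) = (if x = s then 1 else if x = orthogonal_bb84 s then 0 else 1 / 2)"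
proof -
  have [simp]: "complex_of_real (sqrt 2) * complex_of_real (sqrt 2) = 2"
    by (simp flip: of_real_mult)
  show ?thesis
    unfolding mat_trace_mult[OF bb84_state_carrier bb84_state_carrier]
    by (cases x; cases s)
      (simp_all add: index_bb84_state numeral_2_eq_2 vec_of_list_index field_simps)
qed

lemma mat_trace_bb84: "mat_trace (bb84_state x) = 1"
proof -
  have [simp]: "complex_of_real (sqrt 2) * complex_of_real (sqrt 2) = 2"
    by (simp flip: of_real_mult)
  show ?thesis
    by (cases x)
      (simp_all add: mat_trace_def index_bb84_state numeral_2_eq_2 vec_of_list_index field_simps)
qed

text \<open>Both sides are the identity, since each pair of vectors is an orthonormal basis.\<close>

lemma bb84_basis_sum:
  "bb84_state Ket0 + bb84_state Ket1 = bb84_state KetPlus + bb84_state KetMinus"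
proof (rule eq_matI)
  have [simp]: "complex_of_real (sqrt 2) * complex_of_real (sqrt 2) = 2"
    by (simp flip: of_real_mult)
  fix i j assume "i < dim_row (bb84_state KetPlus + bb84_state KetMinus)"
    "j < dim_col (bb84_state KetPlus + bb84_state KetMinus)"
  then have "i = 0 \<or> i = 1" "j = 0 \<or> j = 1"
    by auto
  then show "(bb84_state Ket0 + bb84_state Ket1) $$ (i, j)
      = (bb84_state KetPlus + bb84_state KetMinus) $$ (i, j)"
    by (elim disjE) (simp_all add: index_bb84_state vec_of_list_index field_simps)
qed simp_all

lemma seq_state_carrier: "seq_state K x \<in> carrier_mat (2 ^ K) (2 ^ K)"
  unfolding seq_state_def
  using tensor_list_carrier[of "map (\<lambda>k. bb84_state (x k)) [0..<K]"] bb84_state_carrier by auto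

lemma seq_state_update:
  assumes "k < K"
  shows "seq_state K (x(k := Ket0)) + seq_state K (x(k := Ket1))
       = seq_state K (x(k := KetPlus)) + seq_state K (x(k := KetMinus))"
proof -
  let ?As = "map (\<lambda>k. bb84_state (x k)) [0..<K]"
  have u: "seq_state K (x(k := s)) = tensor_list (?As[k := bb84_state s])" for s
    unfolding seq_state_def
    by (rule arg_cong[of _ _ tensor_list], rule nth_equalityI) (auto simp: nth_list_update)
  have "tensor_list (?As[k := bb84_state s + bb84_state t])
      = tensor_list (?As[k := bb84_state s]) + tensor_list (?As[k := bb84_state t])" for s t
    using assms bb84_state_carrier by (intro tensor_list_update_add) auto
  then show ?thesis
    unfolding u using bb84_basis_sum by metis
qed

section \<open>Likelihoods of Bob's outcomes as functions of the sequence sent\<close>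

definition outcome_prob :: "nat \<Rightarrow> bob_strategy \<Rightarrow> nat \<Rightarrow> (nat \<Rightarrow> bb84) \<Rightarrow> real" where
  "outcome_prob K B i x = Re (mat_trace (kron (seq_state K x) (anc_state B) * povm B i))"

context
  fixes K :: nat and B :: bob_strategy
  assumes B: "valid_strategy K B"
begin

lemma anc_state_carrier: "anc_state B \<in> carrier_mat (anc_dim B) (anc_dim B)"
  and povm_carrier: "i < n_outcomes B \<Longrightarrow>
    povm B i \<in> carrier_mat (2 ^ K * anc_dim B) (2 ^ K * anc_dim B)"
  using B by (auto simp: valid_strategy_def density_operator_def is_povm_def pos_semidef_def)

text \<open>The sequence sent is in a pure product state, so its matrix has rank one; the ancilla
  state may be mixed and is handled by its Gram decomposition.\<close>

lemma outcome_prob_nonneg: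
  assumes "i < n_outcomes B"
  shows "0 \<le> outcome_prob K B i x"
proof -
  let ?As = "map (\<lambda>k. bb84_state (x k)) [0..<K]"
  have "\<exists>f. \<forall>i<2 ^ length ?As. \<forall>j<2 ^ length ?As. tensor_list ?As $$ (i, j) = f i * cnj (f j)"
    using bb84_state_carrier index_bb84_state by (intro tensor_list_rank_one) fastforce
  then obtain f where "\<And>i j. i < 2 ^ K \<Longrightarrow> j < 2 ^ K \<Longrightarrow> seq_state K x $$ (i, j) = f i * cnj (f j)"
    by (auto simp: seq_state_def)
  then show ?thesis
    unfolding outcome_prob_def using B assms
    by (intro trace_rank_one_kron_nonneg[OF seq_state_carrier, where f = f and n = "anc_dim B"])
      (auto simp: valid_strategy_def density_operator_def is_povm_def)
qed

lemma sum_outcome_prob: "(\<Sum>i<n_outcomes B. outcome_prob K B i x) = 1"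
proof -
  have "(\<Sum>i<n_outcomes B. mat_trace (kron (seq_state K x) (anc_state B) * povm B i))
      = mat_trace (kron (seq_state K x) (anc_state B))"
    using B by (intro sum_povm_trace[OF kron_carrier[OF seq_state_carrier anc_state_carrier]])
      (simp add: valid_strategy_def)
  also have "\<dots> = mat_trace (seq_state K x) * mat_trace (anc_state B)"
    by (rule mat_trace_kron[OF seq_state_carrier anc_state_carrier])
  also have "mat_trace (seq_state K x) = 1"
    unfolding seq_state_def
    by (rule mat_trace_tensor_list) (auto simp: bb84_state_carrier mat_trace_bb84)
  also have "mat_trace (anc_state B) = 1"
    using B by (simp add: valid_strategy_def density_operator_def)
  finally have "Re (\<Sum>i<n_outcomes B. mat_trace (kron (seq_state K x) (anc_state B) * povm B i)) = 1"
    by simp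
  then show ?thesis
    by (simp add: outcome_prob_def)
qed

text \<open>Both bases resolve the identity, so no measurement can tell their uniform mixtures apart.\<close>
lemma outcome_prob_update:
  assumes "k < K" "i < n_outcomes B"
  shows "outcome_prob K B i (x(k := Ket0)) + outcome_prob K B i (x(k := Ket1))
       = outcome_prob K B i (x(k := KetPlus)) + outcome_prob K B i (x(k := KetMinus))"
proof -
  have "outcome_prob K B i y + outcome_prob K B i z
      = Re (mat_trace (kron (seq_state K y + seq_state K z) (anc_state B) * povm B i))" for y z
    using mat_trace_add_mult[OF kron_carrier[OF seq_state_carrier anc_state_carrier]
        kron_carrier[OF seq_state_carrier anc_state_carrier] povm_carrier[OF assms(2)]]
    by (simp add: kron_add_left[OF seq_state_carrier seq_state_carrier anc_state_carrier]
        outcome_prob_def)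
  then show ?thesis
    using seq_state_update[OF assms(1)] by simp
qed

lemma pmf_outcome:
  "pmf (born_pmf (kron (seq_state K x) (anc_state B)) {..<n_outcomes B} (povm B)) i
     = (if i < n_outcomes B then outcome_prob K B i x else 0)"
  using outcome_prob_nonneg sum_outcome_prob
  by (subst pmf_born_pmf) (auto simp: outcome_prob_def)

end

section \<open>The Chernoff bound for coherent attacks\<close>

abbreviation bb84_set :: "bb84 set" where
  "bb84_set \<equiv> {Ket0, Ket1, KetPlus, KetMinus}"

abbreviation uniform_seq :: "nat set \<Rightarrow> (nat \<Rightarrow> bb84) pmf" where
  "uniform_seq A \<equiv> Pi_pmf A undefined (\<lambda>_. pmf_of_set bb84_set)"

lemma finite_set_uniform_seq: "finite A \<Longrightarrow> finite (set_pmf (uniform_seq A))"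
  by (auto simp: set_Pi_pmf intro!: finite_PiE_dflt)

lemma expectation_uniform_seq_insert:
  fixes h :: "(nat \<Rightarrow> bb84) \<Rightarrow> real"
  assumes "finite A" "a \<notin> A"
  shows "measure_pmf.expectation (uniform_seq (insert a A)) h
       = measure_pmf.expectation (uniform_seq A) (\<lambda>f. (\<Sum>y\<in>bb84_set. h (f(a := y))) / 4)"
proof -
  \<comment> \<open>\<open>Pi_pmf_insert'\<close> draws the value at a first; commuting the two
    draws makes it the inner average, over a sequence on A already drawn.\<close>
  have "uniform_seq (insert a A)
      = bind_pmf (uniform_seq A) (\<lambda>f. map_pmf (\<lambda>y. f(a := y)) (pmf_of_set bb84_set))"
    unfolding Pi_pmf_insert'[OF assms] map_pmf_def
    by (rule bind_commute_pmf)
  then have "measure_pmf.expectation (uniform_seq (insert a A)) h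
     = (\<Sum>f\<in>set_pmf (uniform_seq A). pmf (uniform_seq A) f *\<^sub>R
        measure_pmf.expectation (map_pmf (\<lambda>y. f(a := y)) (pmf_of_set bb84_set)) h)"
    using finite_set_uniform_seq[OF assms(1)] by (simp only:) (rule pmf_expectation_bind, auto)
  also have "\<dots> = (\<Sum>f\<in>set_pmf (uniform_seq A). pmf (uniform_seq A) f *\<^sub>R
      ((\<Sum>y\<in>bb84_set. h (f(a := y))) / 4))"
    by (intro sum.cong refl) (simp add: integral_pmf_of_set)
  also have "\<dots> = measure_pmf.expectation (uniform_seq A) (\<lambda>f. (\<Sum>y\<in>bb84_set. h (f(a := y))) / 4)"
    using finite_set_uniform_seq[OF assms(1)] by (intro integral_measure_pmf[symmetric]) auto
  finally show ?thesis .
qed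

text \<open>
  \<open>F\<close> plays the role of the likelihood of a measurement outcome. The basis relation is all that
  is left of its quantum origin, and it lets the positions be treated one at a time, however
  \<open>F\<close> correlates them.
\<close>
lemma expectation_weighted_le:
  fixes F :: "(nat \<Rightarrow> bb84) \<Rightarrow> real" and w :: "nat \<Rightarrow> bb84 \<Rightarrow> real" and g :: real
  assumes "finite A" and g: "0 \<le> g" and w: "\<And>k y. 0 \<le> w k y"
    and step: "\<And>k G. (\<And>y. 0 \<le> G y) \<Longrightarrow> G Ket0 + G Ket1 = G KetPlus + G KetMinus \<Longrightarrow>
      (\<Sum>y\<in>bb84_set. w k y * G y) \<le> g * (\<Sum>y\<in>bb84_set. G y)"
    and "\<And>x. 0 \<le> F x"
    and "\<And>k x. k \<in> A \<Longrightarrow>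
      F (x(k := Ket0)) + F (x(k := Ket1)) = F (x(k := KetPlus)) + F (x(k := KetMinus))"
  shows "measure_pmf.expectation (uniform_seq A) (\<lambda>x. F x * (\<Prod>k\<in>A. w k (x k)))
       \<le> g ^ card A * measure_pmf.expectation (uniform_seq A) F"
  using assms(1,5,6)
proof (induction A arbitrary: F rule: finite_induct)
  case empty
  then show ?case by simp
next
  case (insert a A)
  note int = integrable_measure_pmf_finite[OF finite_set_uniform_seq[OF insert.hyps(1)]]
  \<comment> \<open>Averaging out position a keeps the induction going: \<open>F'\<close> is again
    nonnegative and satisfies the basis relation at the other positions, by linearity and because
    updates at distinct positions commute.\<close>
  define F' where "F' f = (\<Sum>y\<in>bb84_set. F (f(a := y))) / 4" for f
  let ?W = "\<lambda>f. \<Prod>k\<in>A. w k (f k)"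
  have W: "?W (f(a := y)) = ?W f" for f y
    using insert.hyps(2) by (intro prod.cong) auto
  have "measure_pmf.expectation (uniform_seq (insert a A)) (\<lambda>x. F x * (\<Prod>k\<in>insert a A. w k (x k)))
      = measure_pmf.expectation (uniform_seq A)
          (\<lambda>f. ?W f * (\<Sum>y\<in>bb84_set. w a y * F (f(a := y))) / 4)"
    unfolding expectation_uniform_seq_insert[OF insert.hyps(1,2)] prod.insert[OF insert.hyps(1,2)] W
    by (simp add: algebra_simps)
  \<comment> \<open>\<open>step\<close> is applied to F as a function of the value at a, with all
    other values frozen; the nonnegative weights at the other positions factor out.\<close>
  also have "\<dots> \<le> measure_pmf.expectation (uniform_seq A) (\<lambda>f. g * (F' f * ?W f))"
  proof (rule integral_mono[OF int int])
    fix f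
    have "(\<Sum>y\<in>bb84_set. w a y * F (f(a := y))) \<le> g * (\<Sum>y\<in>bb84_set. F (f(a := y)))"
      by (rule step) (use insert.prems in blast)+
    then have "?W f * (\<Sum>y\<in>bb84_set. w a y * F (f(a := y))) \<le> ?W f * (g * (\<Sum>y\<in>bb84_set. F (f(a := y))))"
      by (intro mult_left_mono prod_nonneg w)
    then show "?W f * (\<Sum>y\<in>bb84_set. w a y * F (f(a := y))) / 4 \<le> g * (F' f * ?W f)"
      unfolding F'_def by (simp add: algebra_simps del: sum.insert)
  qed
  also have "\<dots> = g * measure_pmf.expectation (uniform_seq A) (\<lambda>f. F' f * ?W f)"
    by simp
  also have "measure_pmf.expectation (uniform_seq A) (\<lambda>f. F' f * ?W f)
      \<le> g ^ card A * measure_pmf.expectation (uniform_seq A) F'"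
  proof (rule insert.IH)
    show "0 \<le> F' x" for x
      using insert.prems(1) by (simp add: F'_def sum_nonneg)
    fix k x assume k: "k \<in> A"
    then have "k \<noteq> a"
      using insert.hyps(2) by auto
    have "F (x(k := Ket0, a := y)) + F (x(k := Ket1, a := y))
        = F (x(k := KetPlus, a := y)) + F (x(k := KetMinus, a := y))" for y
      using insert.prems(2)[OF insertI2[OF k], of "x(a := y)"]
      by (simp only: fun_upd_twist[OF \<open>k \<noteq> a\<close>])
    from this[of Ket0] this[of Ket1] this[of KetPlus] this[of KetMinus]
    show "F' (x(k := Ket0)) + F' (x(k := Ket1)) = F' (x(k := KetPlus)) + F' (x(k := KetMinus))"
      by (simp add: F'_def add_divide_distrib[symmetric])
  qed
  also have "measure_pmf.expectation (uniform_seq A) F' = measure_pmf.expectation (uniform_seq (insert a A)) F"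
    unfolding expectation_uniform_seq_insert[OF insert.hyps(1,2)] F'_def ..
  finally show ?case
    using insert.hyps g by (simp add: mult_left_mono mult.assoc)
qed

section \<open>Charlie's exclusions and their exponential moments\<close>

definition excluded_prob :: "bb84 \<Rightarrow> bb84 \<Rightarrow> real" where
  "excluded_prob x d = (if d = x then 0 else if d = orthogonal_bb84 x then 1 / 2 else 1 / 4)"

lemma pmf_measure_basis:
  assumes "b \<in> bb84_bases"
  shows "pmf (born_pmf (bb84_state x) b bb84_state) s
       = (if s \<in> b then if x = s then 1 else if x = orthogonal_bb84 s then 0 else 1 / 2 else 0)"
proof -
  have "finite b"
    using assms by (auto simp: bb84_bases_def)
  moreover have "(\<Sum>i\<in>b. Re (mat_trace (bb84_state x * bb84_state i))) = 1"
    using assms unfolding bb84_bases_def by (cases x) (auto simp: mat_trace_bb84_mult)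
  ultimately show ?thesis
    by (subst pmf_born_pmf) (simp_all add: mat_trace_bb84_mult)
qed

text \<open>With probability 1/2 Charlie measures in the basis of x and then surely excludes the
  state orthogonal to x. In the other basis both outcomes are equally likely, so each of its states
  is excluded with overall probability 1/4. These are the values of
  \<open>excluded_prob\<close>.\<close>

lemma expectation_use_pmf:
  fixes f :: "bb84 \<Rightarrow> real"
  shows "measure_pmf.expectation (use_pmf (bb84_state x)) f = (\<Sum>e\<in>bb84_set. excluded_prob x e * f e)"
proof -
  have ne: "{Ket0, Ket1} \<noteq> {KetPlus, KetMinus}"
    by auto
  have inner: "measure_pmf.expectation (born_pmf (bb84_state x) b bb84_state \<bind> (\<lambda>s. return_pmf (orthogonal_bb84 s))) f
     = (\<Sum>s\<in>b. pmf (born_pmf (bb84_state x) b bb84_state) s * f (orthogonal_bb84 s))"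
    and fin: "finite (set_pmf (born_pmf (bb84_state x) b bb84_state \<bind> (\<lambda>s. return_pmf (orthogonal_bb84 s))))"
    if b: "b \<in> bb84_bases" for b
  proof -
    have fb: "finite b"
      using b by (auto simp: bb84_bases_def)
    have sb: "set_pmf (born_pmf (bb84_state x) b bb84_state) \<subseteq> b"
      by (auto simp: set_pmf_iff pmf_measure_basis[OF b] split: if_splits)
    show "measure_pmf.expectation (born_pmf (bb84_state x) b bb84_state \<bind> (\<lambda>s. return_pmf (orthogonal_bb84 s))) f
     = (\<Sum>s\<in>b. pmf (born_pmf (bb84_state x) b bb84_state) s * f (orthogonal_bb84 s))"
      by (subst pmf_expectation_bind[OF fb _ sb]) simp_all
    show "finite (set_pmf (born_pmf (bb84_state x) b bb84_state \<bind> (\<lambda>s. return_pmf (orthogonal_bb84 s))))"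
      using finite_subset[OF sb fb] by simp
  qed
  have fin': "finite bb84_bases" "bb84_bases \<noteq> {}"
    by (auto simp: bb84_bases_def)
  have "measure_pmf.expectation (use_pmf (bb84_state x)) f
     = (\<Sum>b\<in>bb84_bases. (\<Sum>s\<in>b. pmf (born_pmf (bb84_state x) b bb84_state) s * f (orthogonal_bb84 s)) /\<^sub>R real (card bb84_bases))"
    unfolding use_pmf_def using fin' fin
    by (subst pmf_expectation_bind_pmf_of_set) (auto simp: inner)
  also have "\<dots> = (\<Sum>b\<in>bb84_bases. (\<Sum>s\<in>b. (if x = s then 1 else if x = orthogonal_bb84 s then 0 else 1 / 2) * f (orthogonal_bb84 s)) / 2)"
  proof -
    have "card bb84_bases = 2"
      using ne by (simp add: bb84_bases_def)
    then show ?thesis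
      by (intro sum.cong refl) (simp add: pmf_measure_basis)
  qed
  also have "\<dots> = (\<Sum>e\<in>bb84_set. excluded_prob x e * f e)"
    unfolding bb84_bases_def
    by (cases x) (simp_all add: ne excluded_prob_def field_simps)
  finally show ?thesis .
qed

text \<open>
  \<open>1 - (1 - q) excluded_prob y d\<close> is the expectation of \<open>q\<close> to the number of mismatches at
  a position where \<open>y\<close> was sent and \<open>d\<close> declared; \<open>1/8\<close> is \<^const>\<open>C_min\<close>.
\<close>
lemma single_position_bound:
  fixes G :: "bb84 \<Rightarrow> real"
  assumes "q \<le> 1" "\<And>y. 0 \<le> G y" "G Ket0 + G Ket1 = G KetPlus + G KetMinus"
  shows "(\<Sum>y\<in>bb84_set. (1 - (1 - q) * excluded_prob y d) * G y)
       \<le> (1 - (1 - q) / 8) * (\<Sum>y\<in>bb84_set. G y)"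
proof -
  have minus: "G KetMinus = G Ket0 + G Ket1 - G KetPlus"
    using assms(3) by simp
  \<comment> \<open>The subtracted weight is \<open>1 - q\<close> times a quarter of the sum of G
    over the basis not containing d, which by the basis relation is an eighth of the total, plus
    half of G at the state orthogonal to d. The bound is attained when that last value is
    zero.\<close>
  have "(\<Sum>y\<in>bb84_set. (1 - (1 - q) * excluded_prob y d) * G y)
      = (1 - (1 - q) / 8) * (\<Sum>y\<in>bb84_set. G y) - (1 - q) / 2 * G (orthogonal_bb84 d)"
    by (cases d) (simp_all add: minus excluded_prob_def field_simps)
  moreover have "0 \<le> (1 - q) / 2 * G (orthogonal_bb84 d)"
    using assms(1,2) by simp
  ultimately show ?thesis
    by simp
qed

text \<open>Markov's inequality for \<open>exp (- s * mismatches)\<close>. Once x and d are fixed,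
  the exclusions at different positions are independent, so the expectation is a product over
  positions.\<close>

lemma prob_few_mismatches_le:
  assumes "0 \<le> s"
  shows "measure_pmf.prob (Pi_pmf {..<K} undefined (\<lambda>k. use_pmf (bb84_state (x k))))
           {e. real (mismatches K d e) < t}
       \<le> exp (s * t) * (\<Prod>k<K. 1 - (1 - exp (- s)) * excluded_prob (x k) (d k))"
proof -
  let ?P = "Pi_pmf {..<K} undefined (\<lambda>k. use_pmf (bb84_state (x k)))"
  have finU: "finite (set_pmf p)" for p :: "bb84 pmf"
  proof (rule finite_subset)
    show "set_pmf p \<subseteq> bb84_set"
      using bb84.exhaust by blast
  qed simp
  have fin: "finite (set_pmf ?P)"
    by (auto simp: set_Pi_pmf intro!: finite_PiE_dflt finU)
  note int = integrable_measure_pmf_finite[OF fin]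
  let ?Q = "\<lambda>e. \<Prod>k<K. if e k = d k then exp (- s) else 1"
  have Q: "exp (- s * real (mismatches K d e)) = ?Q e" for e
  proof -
    have "?Q e = (\<Prod>k\<in>{k \<in> {..<K}. e k = d k}. exp (- s))"
      by (subst prod.inter_filter) auto
    also have "{k \<in> {..<K}. e k = d k} = {k. k < K \<and> d k = e k}"
      by auto
    also have "(\<Prod>k\<in>{k. k < K \<and> d k = e k}. exp (- s)) = exp (- s) ^ mismatches K d e"
      by (simp add: mismatches_def)
    finally show ?thesis
      by (simp add: exp_of_nat_mult[symmetric] mult.commute)
  qed
  have "measure_pmf.prob ?P {e. real (mismatches K d e) < t}
      = measure_pmf.expectation ?P (indicator {e. real (mismatches K d e) < t})"
    by simp
  also have "\<dots> \<le> measure_pmf.expectation ?P (\<lambda>e. exp (s * t) * ?Q e)"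
  proof (rule integral_mono[OF int int])
    fix e
    have "1 \<le> exp (s * (t - real (mismatches K d e)))" if "real (mismatches K d e) < t"
      using that assms by simp
    then show "indicator {e. real (mismatches K d e) < t} e \<le> exp (s * t) * ?Q e"
      unfolding Q[symmetric] mult_exp_exp
      by (auto simp: indicator_def algebra_simps)
  qed
  also have "\<dots> = exp (s * t) * measure_pmf.expectation ?P ?Q"
    by simp
  also have "measure_pmf.expectation ?P ?Q
      = (\<Prod>k<K. measure_pmf.expectation (use_pmf (bb84_state (x k))) (\<lambda>e. if e = d k then exp (- s) else 1))"
    by (rule expectation_prod_Pi_pmf) (auto intro!: integrable_measure_pmf_finite finU)
  also have "\<dots> = (\<Prod>k<K. 1 - (1 - exp (- s)) * excluded_prob (x k) (d k))"
  proof (rule prod.cong[OF refl])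
    fix k
    show "measure_pmf.expectation (use_pmf (bb84_state (x k))) (\<lambda>e. if e = d k then exp (- s) else 1)
        = 1 - (1 - exp (- s)) * excluded_prob (x k) (d k)"
      unfolding expectation_use_pmf
      by (cases "x k"; cases "d k") (simp_all add: excluded_prob_def field_simps)
  qed
  finally show ?thesis .
qed

section \<open>Exponential bounds on the forging probability\<close>

lemma forge_prob_eq:
  "forge_prob K t B = measure_pmf.expectation (uniform_seq {..<K}) (\<lambda>x.
     measure_pmf.expectation (born_pmf (kron (seq_state K x) (anc_state B)) {..<n_outcomes B} (povm B)) (\<lambda>i.
       measure_pmf.expectation (declare_pmf B i) (\<lambda>d.
         measure_pmf.prob (Pi_pmf {..<K} undefined (\<lambda>k. use_pmf (bb84_state (x k))))
           {e. real (mismatches K d e) < t})))"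
proof -
  let ?E = "\<lambda>x. Pi_pmf {..<K} undefined (\<lambda>k. use_pmf (bb84_state (x k)))"
  let ?I = "\<lambda>x. born_pmf (kron (seq_state K x) (anc_state B)) {..<n_outcomes B} (povm B)"
  let ?ok = "\<lambda>(d, e). real (mismatches K d e) < t"
  \<comment> \<open>As the probability of \<open>True\<close>, the event can be unfolded through the
    experiment with \<open>pmf_bind\<close>.\<close>
  have "forge_prob K t B = pmf (map_pmf ?ok (forging_experiment K B)) True"
    unfolding forge_prob_def pmf_map by (rule arg_cong[of _ _ "measure_pmf.prob _"]) auto
  also have "map_pmf ?ok (forging_experiment K B) = do {
      x \<leftarrow> uniform_seq {..<K}; e \<leftarrow> ?E x; i \<leftarrow> ?I x; d \<leftarrow> declare_pmf B i;
      return_pmf (real (mismatches K d e) < t)}"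
    unfolding forging_experiment_def by (simp add: map_bind_pmf)
  \<comment> \<open>Given x, Charlie's record is independent of Bob's outcome and declaration, so
    its draw may be moved past both and is averaged first, for a fixed declaration.\<close>
  also have "\<dots> = do {
      x \<leftarrow> uniform_seq {..<K}; i \<leftarrow> ?I x; d \<leftarrow> declare_pmf B i;
      map_pmf (\<lambda>e. real (mismatches K d e) < t) (?E x)}"
    unfolding map_pmf_def by (subst bind_commute_pmf, subst bind_commute_pmf) (rule refl)
  finally show ?thesis
    by (simp add: pmf_bind pmf_map vimage_def)
qed

text \<open>Needed wherever the per-position factor is multiplied up over the K positions.\<close>

lemma mismatch_factor_nonneg:
  fixes s :: real
  shows "0 \<le> 1 - (1 - exp (- s)) / 8"
proof -
  have "1 - (1 - exp (- s)) / 8 = 7 / 8 + exp (- s) / 8"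
    by (simp add: field_simps)
  then show ?thesis
    by (simp add: add_nonneg_nonneg)
qed

text \<open>The left side is the expectation of \<open>exp (- s * X)\<close> for X equal to 1 with
  probability 1/8 and 0 otherwise. Hoeffding's lemma is applied at the nonnegative argument s to 1 -
  X, of mean 7/8, and the result is multiplied by \<open>exp (- s)\<close>.\<close>

lemma hoeffding_factor:
  fixes s :: real
  assumes "0 \<le> s"
  shows "1 - (1 - exp (- s)) / 8 \<le> exp (s\<^sup>2 / 8 - s / 8)"
proof -
  have pos: "0 < 1 + 7 / 8 * (exp s - 1)"
    using assms by (simp add: add_pos_nonneg)
  have "ln (1 + 7 / 8 * (exp s - 1)) \<le> s\<^sup>2 / 8 + s * (7 / 8)"
    using Hoeffdings_lemma_aux[of s "7 / 8"] assms by simp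
  then have "1 + 7 / 8 * (exp s - 1) \<le> exp (s\<^sup>2 / 8 + s * (7 / 8))"
    using pos by (metis exp_le_cancel_iff exp_ln)
  then have "exp (- s) * (1 + 7 / 8 * (exp s - 1)) \<le> exp (- s) * exp (s\<^sup>2 / 8 + s * (7 / 8))"
    by (intro mult_left_mono) auto
  also have "exp (- s) * exp (s\<^sup>2 / 8 + s * (7 / 8)) = exp (s\<^sup>2 / 8 - s / 8)"
    by (simp add: mult_exp_exp)
  also have "exp (- s) * (1 + 7 / 8 * (exp s - 1)) = 1 - (1 - exp (- s)) / 8"
    by (simp add: algebra_simps exp_minus field_simps)
  finally show ?thesis .
qed

text \<open>For each outcome i, the joint weight of i and a successful forgery is at most a fixed
  factor times the weight of i, for every declaration d. The factor does not depend on d, so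
  randomised declarations gain nothing, and the weights of the outcomes add up to 1.\<close>

lemma forge_prob_chernoff:
  assumes B: "valid_strategy K B" and s: "0 \<le> s"
  shows "forge_prob K t B \<le> exp (s * t) * (1 - (1 - exp (- s)) / 8) ^ K"
proof -
  let ?w = "\<lambda>d y. 1 - (1 - exp (- s)) * excluded_prob y d"
  let ?W = "\<lambda>d x. \<Prod>k<K. ?w (d k) (x k)"
  let ?U = "uniform_seq {..<K}"
  let ?I = "\<lambda>x. born_pmf (kron (seq_state K x) (anc_state B)) {..<n_outcomes B} (povm B)"
  let ?X = "set_pmf ?U"
  let ?g = "1 - (1 - exp (- s)) / 8"
  define \<psi> where "\<psi> x d = measure_pmf.prob (Pi_pmf {..<K} undefined (\<lambda>k. use_pmf (bb84_state (x k))))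
      {e. real (mismatches K d e) < t}" for x d
  have finX: "finite ?X"
    by (rule finite_set_uniform_seq) simp
  have q: "0 \<le> 1 - exp (- s)" "1 - exp (- s) \<le> 1"
    using s by auto
  have w: "0 \<le> ?w d y" for d y
    using mult_mono[of "1 - exp (- s)" 1 "excluded_prob y d" 1] q by (simp add: excluded_prob_def)
  \<comment> \<open>Declarations are functions on all of \<open>nat\<close>, so their distribution
    may have infinite support; integrability comes from \<open>\<psi>\<close> being a
    probability.\<close>
  have int: "integrable (measure_pmf (declare_pmf B i)) (\<lambda>d. \<psi> x d)" for x i
    by (rule measure_pmf.integrable_const_bound[where B = 1]) (auto simp: \<psi>_def)
  have bound: "(\<Sum>x\<in>?X. pmf ?U x * (outcome_prob K B i x * \<psi> x d))
      \<le> exp (s * t) * ?g ^ K * (\<Sum>x\<in>?X. pmf ?U x * outcome_prob K B i x)"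
    if i: "i < n_outcomes B" for i d
  proof -
    have "(\<Sum>x\<in>?X. pmf ?U x * (outcome_prob K B i x * \<psi> x d))
        \<le> (\<Sum>x\<in>?X. pmf ?U x * (outcome_prob K B i x * (exp (s * t) * ?W d x)))"
      unfolding \<psi>_def
      by (intro sum_mono mult_left_mono prob_few_mismatches_le s outcome_prob_nonneg[OF B i]) auto
    also have "\<dots> = exp (s * t) * measure_pmf.expectation ?U (\<lambda>x. outcome_prob K B i x * ?W d x)"
      by (subst integral_measure_pmf[OF finX]) (auto simp: sum_distrib_left algebra_simps)
    \<comment> \<open>Here F is the likelihood of outcome i, and the weights are the exponential
      moments for the fixed declaration d.\<close>
    also have "\<dots> \<le> exp (s * t) * (?g ^ card {..<K} * measure_pmf.expectation ?U (outcome_prob K B i))"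
    proof (intro mult_left_mono expectation_weighted_le)
      show "(\<Sum>y\<in>bb84_set. ?w (d k) y * G y) \<le> ?g * sum G bb84_set"
        if "\<And>y. 0 \<le> G y" "G Ket0 + G Ket1 = G KetPlus + G KetMinus" for k G
        using that q(1) by (intro single_position_bound) auto
      show "0 \<le> ?g"
        by (rule mismatch_factor_nonneg)
    qed (use w outcome_prob_nonneg[OF B i] outcome_prob_update[OF B _ i] in auto)
    also have "measure_pmf.expectation ?U (outcome_prob K B i) = (\<Sum>x\<in>?X. pmf ?U x * outcome_prob K B i x)"
      by (subst integral_measure_pmf[OF finX]) auto
    finally show ?thesis
      by simp
  qed
  have "forge_prob K t B = (\<Sum>x\<in>?X. pmf ?U x *
      measure_pmf.expectation (?I x) (\<lambda>i. measure_pmf.expectation (declare_pmf B i) (\<psi> x)))"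
    unfolding forge_prob_eq \<psi>_def by (subst integral_measure_pmf[OF finX]) auto
  also have "\<dots> = (\<Sum>x\<in>?X. pmf ?U x *
      (\<Sum>i<n_outcomes B. outcome_prob K B i x * measure_pmf.expectation (declare_pmf B i) (\<psi> x)))"
    by (subst integral_measure_pmf[of "{..<n_outcomes B}"])
      (auto simp: pmf_outcome[OF B] set_pmf_iff split: if_splits)
  also have "\<dots> = (\<Sum>x\<in>?X. \<Sum>i<n_outcomes B.
      measure_pmf.expectation (declare_pmf B i) (\<lambda>d. pmf ?U x * (outcome_prob K B i x * \<psi> x d)))"
    by (simp add: sum_distrib_left)
  also have "\<dots> = (\<Sum>i<n_outcomes B. \<Sum>x\<in>?X.
      measure_pmf.expectation (declare_pmf B i) (\<lambda>d. pmf ?U x * (outcome_prob K B i x * \<psi> x d)))"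
    by (rule sum.swap)
  \<comment> \<open>The sum over x moves inside the average over d, where \<open>bound\<close>
    applies to each d separately.\<close>
  also have "\<dots> = (\<Sum>i<n_outcomes B. measure_pmf.expectation (declare_pmf B i)
      (\<lambda>d. \<Sum>x\<in>?X. pmf ?U x * (outcome_prob K B i x * \<psi> x d)))"
    by (intro sum.cong refl Bochner_Integration.integral_sum[symmetric] integrable_mult_right int)
  also have "\<dots> \<le> (\<Sum>i<n_outcomes B. exp (s * t) * ?g ^ K * (\<Sum>x\<in>?X. pmf ?U x * outcome_prob K B i x))"
  proof (rule sum_mono)
    fix i assume "i \<in> {..<n_outcomes B}"
    then show "measure_pmf.expectation (declare_pmf B i)
          (\<lambda>d. \<Sum>x\<in>?X. pmf ?U x * (outcome_prob K B i x * \<psi> x d))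
        \<le> exp (s * t) * ?g ^ K * (\<Sum>x\<in>?X. pmf ?U x * outcome_prob K B i x)"
      by (intro measure_pmf.integral_le_const Bochner_Integration.integrable_sum
          integrable_mult_right int always_eventually allI bound) simp
  qed
  also have "\<dots> = exp (s * t) * ?g ^ K * (\<Sum>i<n_outcomes B. \<Sum>x\<in>?X. pmf ?U x * outcome_prob K B i x)"
    by (simp only: sum_distrib_left)
  also have "(\<Sum>i<n_outcomes B. \<Sum>x\<in>?X. pmf ?U x * outcome_prob K B i x)
      = (\<Sum>x\<in>?X. pmf ?U x * (\<Sum>i<n_outcomes B. outcome_prob K B i x))"
    unfolding sum_distrib_left by (rule sum.swap)
  also have "\<dots> = 1"
    using finX by (simp add: sum_outcome_prob[OF B] sum_pmf_eq_1)
  finally show ?thesis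
    by simp
qed

lemma forge_prob_hoeffding:
  assumes B: "valid_strategy K B" and K: "1 \<le> K" and t: "t / real K < C_min"
  shows "forge_prob K t B \<le> exp (- 2 * (C_min - t / real K)\<^sup>2 * real K)"
proof -
  define \<delta> where "\<delta> = C_min - t / real K"
  have \<delta>: "0 < \<delta>" and t': "t = (1 / 8 - \<delta>) * real K"
    using t K by (auto simp: \<delta>_def C_min_def)
  \<comment> \<open>\<open>s = 4\<delta>\<close> minimises the exponent \<open>K (s\<^sup>2 / 8 - s \<delta>)\<close> obtained from Hoeffding's lemma.\<close>
  have "forge_prob K t B \<le> exp (4 * \<delta> * t) * (1 - (1 - exp (- (4 * \<delta>))) / 8) ^ K"
    using \<delta> by (intro forge_prob_chernoff[OF B]) simp
  also have "\<dots> \<le> exp (4 * \<delta> * t) * exp ((4 * \<delta>)\<^sup>2 / 8 - 4 * \<delta> / 8) ^ K"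
  proof (intro mult_left_mono power_mono)
    show "1 - (1 - exp (- (4 * \<delta>))) / 8 \<le> exp ((4 * \<delta>)\<^sup>2 / 8 - 4 * \<delta> / 8)"
      using \<delta> by (intro hoeffding_factor) simp
    show "0 \<le> 1 - (1 - exp (- (4 * \<delta>))) / 8"
      by (rule mismatch_factor_nonneg)
  qed simp
  also have "\<dots> = exp (4 * \<delta> * t + real K * ((4 * \<delta>)\<^sup>2 / 8 - 4 * \<delta> / 8))"
    by (simp add: exp_add exp_of_nat_mult)
  also have "4 * \<delta> * t + real K * ((4 * \<delta>)\<^sup>2 / 8 - 4 * \<delta> / 8) = - 2 * \<delta>\<^sup>2 * real K"
    unfolding t' by (simp add: algebra_simps power2_eq_square)
  finally show ?thesis
    by (simp add: \<delta>_def)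
qed

theorem theorem2:
  fixes r s_v :: real
  assumes "0 \<le> r" and "r < 1 / 2" and "0 < s_v"
  shows "(\<forall>L K :: nat. 1 \<le> L \<and> 1 \<le> K \<and> real K = real L * (1 / 2 - r) \<longrightarrow>
            (s_v * real L / real K < C_min \<longleftrightarrow> s_v < 1 / 16 * (1 - 2 * r)))
       \<and> (\<forall>(L::nat) (K::nat) B. 1 \<le> L \<and> 1 \<le> K \<and> real K = real L * (1 / 2 - r) \<and>
            s_v * real L / real K < C_min \<and> valid_strategy K B \<longrightarrow>
            forge_prob K (s_v * real L) B
              \<le> exp (- 2 * (C_min - s_v * real L / real K)\<^sup>2 * real K))
       \<and> (s_v < 1 / 16 * (1 - 2 * r) \<longrightarrow>
            (\<exists>c>0. \<forall>(L::nat) (K::nat) B. 1 \<le> L \<and> 1 \<le> K \<and> real K = real L * (1 / 2 - r) \<and>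
               valid_strategy K B \<longrightarrow>
               forge_prob K (s_v * real L) B \<le> exp (- c * real L)))"
proof (intro conjI allI impI)
  have ratio: "s_v * real L / real K = s_v / (1 / 2 - r)" if "1 \<le> L" "real K = real L * (1 / 2 - r)" for L K :: nat
    using that by simp
  fix L K :: nat
  assume "1 \<le> L \<and> 1 \<le> K \<and> real K = real L * (1 / 2 - r)"
  then have "s_v * real L / real K = s_v / (1 / 2 - r)"
    by (intro ratio) auto
  then show "s_v * real L / real K < C_min \<longleftrightarrow> s_v < 1 / 16 * (1 - 2 * r)"
    using assms(2) by (simp add: C_min_def pos_divide_less_eq) linarith
next
  fix L K :: nat and B
  assume "1 \<le> L \<and> 1 \<le> K \<and> real K = real L * (1 / 2 - r) \<and>
    s_v * real L / real K < C_min \<and> valid_strategy K B"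
  then show "forge_prob K (s_v * real L) B \<le> exp (- 2 * (C_min - s_v * real L / real K)\<^sup>2 * real K)"
    by (intro forge_prob_hoeffding) auto
next
  assume sv: "s_v < 1 / 16 * (1 - 2 * r)"
  \<comment> \<open>The ratio of \<open>s_v * real L\<close> to K depends only on s_v and r, so the
    gap \<delta> is the same for all L.\<close>
  define \<delta> where "\<delta> = C_min - s_v / (1 / 2 - r)"
  have \<delta>: "0 < \<delta>"
    using sv assms(2) by (simp add: \<delta>_def C_min_def pos_divide_less_eq)
  show "\<exists>c>0. \<forall>(L::nat) (K::nat) B. 1 \<le> L \<and> 1 \<le> K \<and> real K = real L * (1 / 2 - r) \<and>
      valid_strategy K B \<longrightarrow> forge_prob K (s_v * real L) B \<le> exp (- c * real L)"
  \<comment> \<open>The exponent \<open>2 * \<delta>\<^sup>2 * real K\<close> rewritten per unit of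
    L, using that K is L times 1/2 - r; the rate is thus fixed before L, K and B.\<close>
  proof (intro exI[of _ "2 * \<delta>\<^sup>2 * (1 / 2 - r)"] conjI allI impI)
    show "0 < 2 * \<delta>\<^sup>2 * (1 / 2 - r)"
      using \<delta> assms(2) by simp
    fix L K :: nat and B
    assume *: "1 \<le> L \<and> 1 \<le> K \<and> real K = real L * (1 / 2 - r) \<and> valid_strategy K B"
    then have d: "C_min - s_v * real L / real K = \<delta>"
      by (simp add: \<delta>_def)
    have "forge_prob K (s_v * real L) B \<le> exp (- 2 * (C_min - s_v * real L / real K)\<^sup>2 * real K)"
      using * d \<delta> by (intro forge_prob_hoeffding) auto
    then show "forge_prob K (s_v * real L) B \<le> exp (- (2 * \<delta>\<^sup>2 * (1 / 2 - r)) * real L)"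
      unfolding d using * by (simp add: algebra_simps)
  qed
qed

end
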